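(* Let $n\in\{1,2,\dots\}$ or $n=\infty$. Let $T:=[T_1,\dots,T_n]$, $T_i\in B(\mathcal H)$, be a row contraction and let $V:=[V_1,\dots,V_n]$, $V_i\in B(\mathcal K)$, be an isometric lifting of $T$ on a Hilbert space $\mathcal K\supseteq\mathcal H$. Let $\mathcal X$ be a Hilbert space, let $\mathcal X_i\subseteq\mathcal X$, $i=1,\dots,n$, be (pairwise) orthogonal subspaces and let $R_i\in B(\mathcal X_i,\mathcal X)$ be contractions. If $A\in B(\mathcal X,\mathcal H)$ is such that $$T_iAR_i=A|_{\mathcal X_i}\quad\text{for every } i=1,\dots,n,$$ then there is an operator $B\in B(\mathcal X,\mathcal K)$ such that $P_{\mathcal H}B=A$, $\|B\|=\|A\|$, and $$V_iBR_i=B|_{\mathcal X_i}\quad\text{for every } i=1,\dots,n.$$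
   Context: All spaces are complex Hilbert spaces, subspaces are closed; $B(\mathcal X,\mathcal H)$ denotes the bounded linear operators from $\mathcal X$ to $\mathcal H$ and $B(\mathcal H)=B(\mathcal H,\mathcal H)$. $P_{\mathcal H}$ is the orthogonal projection of $\mathcal K$ onto $\mathcal H$. A row contraction is a sequence $[T_1,\dots,T_n]$ with $T_i\in B(\mathcal H)$ and $T_1T_1^*+\cdots+T_nT_n^*\le I_{\mathcal H}$. An isometric lifting of $T$ on $\mathcal K\supseteq\mathcal H$ is a sequence $[V_1,\dots,V_n]$, $V_i\in B(\mathcal K)$, with $V_i^*V_j=\delta_{ij}I_{\mathcal K}$ and $P_{\mathcal H}V_i=T_iP_{\mathcal H}$ for all $i,j$. *)

theory Defs
  imports "HOL-Analysis.Analysis" "HOL-Library.Extended_Nat"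
begin

(* Complex inner product spaces are built on top of real_inner, so that norm, topology and
   completeness are those of the library; inner_eq_Re_cinner makes norm x = sqrt (Re (cinner x x)).
   The complex inner product is linear in the first and conjugate-linear in the second argument. *)
class complex_inner_space = real_inner +
  fixes scaleC :: "complex \<Rightarrow> 'a \<Rightarrow> 'a" (infixr "*\<^sub>C" 75)
    and cinner :: "'a \<Rightarrow> 'a \<Rightarrow> complex"
  assumes scaleC_add_right: "a *\<^sub>C (x + y) = a *\<^sub>C x + a *\<^sub>C y"
    and scaleC_add_left: "(a + b) *\<^sub>C x = a *\<^sub>C x + b *\<^sub>C x"
    and scaleC_scaleC: "a *\<^sub>C b *\<^sub>C x = (a * b) *\<^sub>C x"
    and scaleR_eq_scaleC: "r *\<^sub>R x = complex_of_real r *\<^sub>C x"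
    and cinner_add_left: "cinner (x + y) z = cinner x z + cinner y z"
    and cinner_scaleC_left: "cinner (a *\<^sub>C x) y = a * cinner x y"
    and cinner_commute: "cinner x y = cnj (cinner y x)"
    and inner_eq_Re_cinner: "inner x y = Re (cinner x y)"

class complex_hilbert_space = complex_inner_space + complete_space

instantiation complex :: complex_hilbert_space
begin

definition scaleC_complex :: "complex \<Rightarrow> complex \<Rightarrow> complex"
  where "scaleC_complex a x = a * x"

definition cinner_complex :: "complex \<Rightarrow> complex \<Rightarrow> complex"
  where "cinner_complex x y = x * cnj y"

instance
  by standard
    (auto simp: scaleC_complex_def cinner_complex_def algebra_simps scaleR_conv_of_real
      inner_complex_def)

end

definition closed_csubspace :: "'a::complex_inner_space set \<Rightarrow> bool"
  where "closed_csubspace S \<longleftrightarrow>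
    0 \<in> S \<and> (\<forall>x\<in>S. \<forall>y\<in>S. x + y \<in> S) \<and> (\<forall>c. \<forall>x\<in>S. c *\<^sub>C x \<in> S) \<and> closed S"

(* B(S, S') for closed subspaces S, S' of two ambient Hilbert spaces. An operator is represented
   by a function on the ambient type; its values outside S are irrelevant, so operators
   on S are always to be compared on S only. *)
definition bdd_ops ::
    "'a::complex_inner_space set \<Rightarrow> 'b::complex_inner_space set \<Rightarrow> ('a \<Rightarrow> 'b) set"
  where "bdd_ops S S' = {T.
    (\<forall>x\<in>S. T x \<in> S') \<and>
    (\<forall>x\<in>S. \<forall>y\<in>S. T (x + y) = T x + T y) \<and>
    (\<forall>c. \<forall>x\<in>S. T (c *\<^sub>C x) = c *\<^sub>C T x) \<and>
    (\<exists>M. \<forall>x\<in>S. norm (T x) \<le> M * norm x)}"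

(* The adjoint in B(S', S) of an operator in B(S, S'). The value is well defined for y in S'
   whenever S is a closed subspace of a Hilbert space, by the Riesz representation theorem. *)
definition adj_on ::
    "'a::complex_inner_space set \<Rightarrow> ('a \<Rightarrow> 'b::complex_inner_space) \<Rightarrow> 'b \<Rightarrow> 'a"
  where "adj_on S T y = (THE z. z \<in> S \<and> (\<forall>x\<in>S. cinner (T x) y = cinner x z))"

definition orth_proj :: "'a::complex_inner_space set \<Rightarrow> 'a \<Rightarrow> 'a"
  where "orth_proj S x = (THE y. y \<in> S \<and> (\<forall>z\<in>S. cinner (x - y) z = 0))"

definition contraction_on ::
    "'a::complex_inner_space set \<Rightarrow> ('a \<Rightarrow> 'b::complex_inner_space) \<Rightarrow> bool"
  where "contraction_on S T \<longleftrightarrow> T \<in> bdd_ops S UNIV \<and> (\<forall>x\<in>S. norm (T x) \<le> norm x)"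

definition op_le_on :: "'a::complex_inner_space set \<Rightarrow> ('a \<Rightarrow> 'a) \<Rightarrow> ('a \<Rightarrow> 'a) \<Rightarrow> bool"
  where "op_le_on S P Q \<longleftrightarrow> (\<forall>x\<in>S. cinner (Q x - P x) x \<in> \<real>\<^sub>\<ge>\<^sub>0)"

definition indices :: "enat \<Rightarrow> nat set"
  where "indices n = {i. 1 \<le> i \<and> enat i \<le> n}"

(* For n = \<infinity> the sum of the T i (T i)* is taken in the strong operator topology. *)
definition row_contraction ::
    "enat \<Rightarrow> 'a::complex_hilbert_space set \<Rightarrow> (nat \<Rightarrow> 'a \<Rightarrow> 'a) \<Rightarrow> bool"
  where "row_contraction n H T \<longleftrightarrow>
    (\<forall>i\<in>indices n. T i \<in> bdd_ops H H) \<and>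
    (\<forall>h\<in>H. (\<lambda>i. T i (adj_on H (T i) h)) summable_on indices n) \<and>
    op_le_on H (\<lambda>h. \<Sum>\<^sub>\<infinity>i\<in>indices n. T i (adj_on H (T i) h)) (\<lambda>h. h)"

definition isometric_lifting ::
    "enat \<Rightarrow> 'a::complex_hilbert_space set \<Rightarrow> (nat \<Rightarrow> 'a \<Rightarrow> 'a) \<Rightarrow> (nat \<Rightarrow> 'a \<Rightarrow> 'a) \<Rightarrow> bool"
  where "isometric_lifting n H T V \<longleftrightarrow>
    (\<forall>i\<in>indices n. V i \<in> bdd_ops UNIV UNIV) \<and>
    (\<forall>i\<in>indices n. \<forall>j\<in>indices n. \<forall>x.
      adj_on UNIV (V i) (V j x) = (if i = j then x else 0)) \<and>
    (\<forall>i\<in>indices n. \<forall>x. orth_proj H (V i x) = T i (orth_proj H x))"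

definition orthogonal_sets :: "'a::complex_inner_space set \<Rightarrow> 'a set \<Rightarrow> bool"
  where "orthogonal_sets S S' \<longleftrightarrow> (\<forall>x\<in>S. \<forall>y\<in>S'. cinner x y = 0)"

end

(* Exhaust K by subspaces H = H_0 <= H_1 <= ... such that V_i maps H_m into H_(m+1) and the
   complement of H_m into the complement of H_(m+1). Since P_(m+1) V_i then factors through P_m,
   a lift A_(m+1) of A_m to H_(m+1) satisfies the intertwining relation up to the projection onto
   H_(m+1) as soon as it equals V_i A_m R_i on every X_i. As the ranges of the V_i and the X_i are
   orthogonal, these prescriptions define an operator of norm at most |A| on the span of the X_i,
   and Parrott's lemma extends it to a lift of A_m. The norms |A_m x| increase to a finite limit,
   so that A_m x is a Cauchy sequence, and B x is its limit. *)
theory Submission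
  imports Defs
begin

text \<open>The relation V_i B R_i = B on X_i has the unknown on both sides, so its right side
  cannot be prescribed directly in K. The chain removes the circularity: at stage m+1 the left side
  depends only on the known A_m. The condition that Parrott's lemma puts on the prescribed values,
  P_m V_i A_m R_i = A_m on X_i, is the relation already solved at stage m; for m = 0 it is the
  hypothesis on T_i, A and R_i. The bound |A| passes through all stages since Parrott's lemma loses
  nothing. The union of the H_m need not be dense in K; B takes its values in the closure of that
  union.

  In Parrott's lemma the defect is kept as a positive, possibly degenerate form rather than as the
  square root of a defect operator. The underlying extension lemma for contractions with respect to
  such forms, applied to the inner product itself, also yields the orthogonal projections.\<close>

section \<open>Complex inner product spaces\<close>

lemma scaleC_minus_one: "(-1) *\<^sub>C (x::'a::complex_inner_space) = - x"
  using scaleR_eq_scaleC[of "-1" x] by simp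

lemma scaleC_zero_left [simp]: "0 *\<^sub>C (x::'a::complex_inner_space) = 0"
  using scaleR_eq_scaleC[of 0 x] by simp

lemma scaleC_zero_right [simp]: "c *\<^sub>C (0::'a::complex_inner_space) = 0"
  using scaleC_add_right[of c 0 0] by simp

lemma scaleC_diff_right: "c *\<^sub>C ((x::'a::complex_inner_space) - y) = c *\<^sub>C x - c *\<^sub>C y"
  using scaleC_add_right[of c "x - y" y] by (simp add: algebra_simps)

lemma scaleC_sum_right:
  "c *\<^sub>C (\<Sum>i\<in>F. f i) = (\<Sum>i\<in>F. c *\<^sub>C (f i :: 'a::complex_inner_space))"
  by (induction F rule: infinite_finite_induct) (simp_all add: scaleC_add_right)

lemma cinner_add_right: "cinner x (y + z) = cinner x y + cinner x z"
  by (metis cinner_add_left cinner_commute complex_cnj_add)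

lemma cinner_scaleC_right: "cinner x (c *\<^sub>C y) = cnj c * cinner x y"
  by (metis cinner_commute cinner_scaleC_left complex_cnj_mult)

lemma cinner_zero_left [simp]: "cinner 0 x = 0"
  using cinner_scaleC_left[of 0 0 x] by simp

lemma cinner_zero_right [simp]: "cinner x 0 = 0"
  using cinner_scaleC_right[of x 0 0] by simp

lemma cinner_diff_left: "cinner (x - y) z = cinner x z - cinner y z"
  using cinner_add_left[of "x - y" y z] by (simp add: algebra_simps)

lemma cinner_diff_right: "cinner x (y - z) = cinner x y - cinner x z"
  using cinner_add_right[of x "y - z" z] by (simp add: algebra_simps)

lemma cinner_eq_zero_commute: "cinner x y = 0 \<longleftrightarrow> cinner y x = 0"
  by (metis cinner_commute complex_cnj_zero)

lemma inner_scaleC_left: "inner (c *\<^sub>C x) y = inner x (cnj c *\<^sub>C y)"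
  by (simp add: inner_eq_Re_cinner cinner_scaleC_left cinner_scaleC_right)

text \<open>Since Re (\<i> z) = - Im z, the second condition is the vanishing of the imaginary part.
  This carries results about the real inner product over to complex orthogonality.\<close>

lemma cinner_eq_zero_iff_inner: "cinner x y = 0 \<longleftrightarrow> inner x y = 0 \<and> inner (\<i> *\<^sub>C x) y = 0"
  by (simp add: inner_eq_Re_cinner cinner_scaleC_left complex_eq_iff)

lemma cinner_imp_inner_eq_zero: "cinner x y = 0 \<Longrightarrow> inner x y = 0"
  by (simp add: cinner_eq_zero_iff_inner)

lemma cinner_self: "cinner x x = complex_of_real ((norm x)\<^sup>2)"
proof -
  have "Im (cinner x x) = 0"
    using cinner_commute[of x x] by (metis Reals_cnj_iff complex_is_Real_iff)
  moreover have "Re (cinner x x) = (norm x)\<^sup>2"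
    by (metis inner_eq_Re_cinner power2_norm_eq_inner)
  ultimately show ?thesis by (simp add: complex_eq_iff)
qed

lemma norm_scaleC: "norm (c *\<^sub>C (x::'a::complex_inner_space)) = cmod c * norm x"
proof -
  have "complex_of_real ((norm (c *\<^sub>C x))\<^sup>2) = complex_of_real ((cmod c * norm x)\<^sup>2)"
    unfolding power_mult_distrib of_real_mult complex_norm_square[of c]
    by (simp add: cinner_self[symmetric] cinner_scaleC_left cinner_scaleC_right
        del: of_real_power)
  then have "(norm (c *\<^sub>C x))\<^sup>2 = (cmod c * norm x)\<^sup>2" using of_real_eq_iff by blast
  then show ?thesis by simp
qed

lemma tendsto_scaleC:
  "(f \<longlongrightarrow> l) F \<Longrightarrow> ((\<lambda>n. c *\<^sub>C f n) \<longlongrightarrow> c *\<^sub>C (l::'a::complex_inner_space)) F"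
proof -
  have "bounded_linear (\<lambda>x::'a. c *\<^sub>C x)"
    by (rule bounded_linear_intro[of _ "cmod c"])
      (auto simp: scaleC_add_right scaleR_eq_scaleC scaleC_scaleC norm_scaleC mult.commute)
  then show "(f \<longlongrightarrow> l) F \<Longrightarrow> ?thesis" by (rule bounded_linear.tendsto)
qed

section \<open>Closed subspaces and bounded operators on them\<close>

lemma closed_csubspaceD:
  assumes "closed_csubspace S"
  shows "0 \<in> S" "x \<in> S \<Longrightarrow> y \<in> S \<Longrightarrow> x + y \<in> S" "x \<in> S \<Longrightarrow> c *\<^sub>C x \<in> S"
    "x \<in> S \<Longrightarrow> y \<in> S \<Longrightarrow> x - y \<in> S" "closed S"
proof -
  have *: "- y = (-1) *\<^sub>C y" for y :: 'a by (simp add: scaleC_minus_one)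
  show "x \<in> S \<Longrightarrow> y \<in> S \<Longrightarrow> x - y \<in> S"
    using assms *[of y] unfolding closed_csubspace_def by (metis diff_conv_add_uminus)
qed (use assms in \<open>auto simp: closed_csubspace_def\<close>)

lemma bdd_opsD:
  assumes "T \<in> bdd_ops S S'"
  shows "x \<in> S \<Longrightarrow> T x \<in> S'" "x \<in> S \<Longrightarrow> y \<in> S \<Longrightarrow> T (x + y) = T x + T y"
    "x \<in> S \<Longrightarrow> T (c *\<^sub>C x) = c *\<^sub>C T x"
  using assms by (auto simp: bdd_ops_def)

lemma bdd_opsI:
  assumes "\<And>x. x \<in> S \<Longrightarrow> T x \<in> S'" "\<And>x y. x \<in> S \<Longrightarrow> y \<in> S \<Longrightarrow> T (x + y) = T x + T y"
    "\<And>c x. x \<in> S \<Longrightarrow> T (c *\<^sub>C x) = c *\<^sub>C T x" "\<And>x. x \<in> S \<Longrightarrow> norm (T x) \<le> M * norm x"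
  shows "T \<in> bdd_ops S S'"
  unfolding bdd_ops_def using assms by blast

lemma bdd_ops_imp_bounded_linear:
  assumes "T \<in> bdd_ops UNIV S"
  shows "bounded_linear T"
proof -
  obtain M where "\<And>x. norm (T x) \<le> M * norm x" using assms by (auto simp: bdd_ops_def)
  then show ?thesis
    by (intro bounded_linear_intro[of _ M])
      (auto simp: scaleR_eq_scaleC bdd_opsD[OF assms] mult.commute)
qed

section \<open>Extending contractions with respect to a semi-inner product\<close>

lemma quadratic_nonneg_imp_discriminant:
  fixes a b c :: real
  assumes "\<And>t. 0 \<le> a + 2 * t * b + t\<^sup>2 * c" and "0 \<le> c"
  shows "\<bar>b\<bar> \<le> sqrt a * sqrt c"
proof -
  have "b\<^sup>2 \<le> a * c"
  proof (cases "c = 0")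
    case True
    have "b = 0"
    proof (rule ccontr)
      assume "b \<noteq> 0"
      \<comment> \<open>At this \<open>t\<close> the affine function a + 2 t b takes the value
        -1.\<close>
      then show False using assms(1)[of "- (a + 1) / (2 * b)"] True by (simp add: field_simps)
    qed
    then show ?thesis using True by simp
  next
    case False
    \<comment> \<open>The minimum of the parabola, where its value is a - b^2 / c.\<close>
    then show ?thesis using assms(1)[of "- b / c"] assms(2)
      by (simp add: field_simps power2_eq_square)
  qed
  then show ?thesis by (metis real_sqrt_abs real_sqrt_le_mono real_sqrt_mult)
qed

(* If G is the graph of D0, then D is D0 composed with the projection, orthogonal with respect to b,
   onto the closure of the domain of D0. As b may be degenerate, this projection is replaced by
   minimising sequences. *)
lemma form_contraction_extension:
  fixes b :: "'x::complex_inner_space \<Rightarrow> 'x \<Rightarrow> real"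
    and G :: "('x \<times> 'k::complex_hilbert_space) set"
  assumes b_add: "\<And>x y z. b (x + y) z = b x z + b y z"
    and b_sym: "\<And>x y. b x y = b y x"
    and b_scale: "\<And>c x y. b (c *\<^sub>C x) y = b x (cnj c *\<^sub>C y)"
    and b_scaleR: "\<And>r x y. b (r *\<^sub>R x) y = r * b x y"
    and b_nonneg: "\<And>x. 0 \<le> b x x"
    and G0: "(0, 0) \<in> G"
    and G_add: "\<And>x k y l. (x, k) \<in> G \<Longrightarrow> (y, l) \<in> G \<Longrightarrow> (x + y, k + l) \<in> G"
    and G_scale: "\<And>c x k. (x, k) \<in> G \<Longrightarrow> (c *\<^sub>C x, c *\<^sub>C k) \<in> G"
    and G_le: "\<And>x k. (x, k) \<in> G \<Longrightarrow> (norm k)\<^sup>2 \<le> b x x"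
  obtains D where "\<And>x y. D (x + y) = D x + D y" "\<And>c x. D (c *\<^sub>C x) = c *\<^sub>C D x"
    "\<And>x. (norm (D x))\<^sup>2 \<le> b x x" "\<And>x k. (x, k) \<in> G \<Longrightarrow> D x = k"
    "\<And>x. D x \<in> closure (snd ` G)"
proof -
  have b_diff: "b (x - y) z = b x z - b y z" for x y z
    using b_add[of "x - y" y z] by simp
  have b_add2: "b z (x + y) = b z x + b z y" for x y z
    using b_add b_sym by metis
  have b_scaleR2: "b x (r *\<^sub>R y) = r * b x y" for r x y
    using b_scaleR b_sym by metis
  have G_diff: "(x - y, k - l) \<in> G" if "(x, k) \<in> G" "(y, l) \<in> G" for x k y l
    using G_add[OF that(1) G_scale[OF that(2), of "-1"]] by (simp add: scaleC_minus_one)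
  have CS: "\<bar>b x y\<bar> \<le> sqrt (b x x) * sqrt (b y y)" for x y
  proof (rule quadratic_nonneg_imp_discriminant)
    show "0 \<le> b x x + 2 * t * b x y + t\<^sup>2 * b y y" for t
      using b_nonneg[of "x + t *\<^sub>R y"] b_sym[of y x]
      by (simp add: b_add b_add2 b_scaleR b_scaleR2 power2_eq_square algebra_simps)
  qed (rule b_nonneg)
  have sqrt_b_scale: "sqrt (b (c *\<^sub>C y) (c *\<^sub>C y)) = cmod c * sqrt (b y y)" for c y
  proof -
    have "c * cnj c = complex_of_real ((cmod c)\<^sup>2)" by (rule complex_norm_square[symmetric])
    then have "b (c *\<^sub>C y) (c *\<^sub>C y) = b y (((cmod c)\<^sup>2) *\<^sub>R y)"
      unfolding b_scale scaleR_eq_scaleC by (simp add: scaleC_scaleC mult.commute)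
    then show ?thesis by (simp add: b_scaleR2 real_sqrt_mult)
  qed
  have norm_G: "norm k \<le> sqrt (b x x)" if "(x, k) \<in> G" for x k
    using G_le[OF that] by (metis real_le_rsqrt)

  \<comment> \<open>Quantitative orthogonality to the domain of \<open>G\<close>: the functional
    \<open>b u\<close> has norm at most \<open>\<epsilon>\<close> there, for the seminorm of
    \<open>b\<close>. Nothing forces \<open>\<epsilon>\<close> to be nonnegative when that seminorm
    vanishes on the domain, hence the absolute values in later bounds.\<close>
  define small where "small u \<epsilon> \<longleftrightarrow> (\<forall>(y, l)\<in>G. \<bar>b u y\<bar> \<le> \<epsilon> * sqrt (b y y))" for u \<epsilon>
  \<comment> \<open>The points \<open>s n\<close> replace the projection of \<open>x\<close> onto
    the domain. They need not converge; only their images \<open>k n\<close> are asked to, in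
    \<open>D'\<close>.\<close>
  define appr where "appr x s k e \<longleftrightarrow> (\<forall>n::nat. (s n, k n) \<in> G \<and> small (x - s n) (e n)) \<and> e \<longlonglongrightarrow> 0"
    for x s k e
  define D' where "D' x l \<longleftrightarrow> (\<exists>s k e. appr x s k e \<and> k \<longlonglongrightarrow> l)" for x l

  have small_add: "small (u + v) (d + e)" if "small u d" "small v e" for u v d e
    unfolding small_def
  proof clarify
    fix y l assume "(y, l) \<in> G"
    then have "\<bar>b u y\<bar> \<le> d * sqrt (b y y)" "\<bar>b v y\<bar> \<le> e * sqrt (b y y)"
      using that by (auto simp: small_def)
    then show "\<bar>b (u + v) y\<bar> \<le> (d + e) * sqrt (b y y)"
      by (simp add: b_add algebra_simps)
  qed
  have small_scale: "small (c *\<^sub>C u) (cmod c * d)" if "small u d" for c u d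
    unfolding small_def
  proof clarify
    fix y l assume "(y, l) \<in> G"
    then have "\<bar>b u (cnj c *\<^sub>C y)\<bar> \<le> d * sqrt (b (cnj c *\<^sub>C y) (cnj c *\<^sub>C y))"
      using that G_scale by (fastforce simp: small_def)
    then show "\<bar>b (c *\<^sub>C u) y\<bar> \<le> cmod c * d * sqrt (b y y)"
      unfolding b_scale[of c u] sqrt_b_scale by (simp add: algebra_simps)
  qed
  have small_diff: "small (u - v) (d + e)" if "small u d" "small v e" for u v d e
    using small_add[OF that(1) small_scale[OF that(2), of "-1"]] by (simp add: scaleC_minus_one)

  have D'_add: "D' (x + y) (k + l)" if "D' x k" "D' y l" for x y k l
  proof -
    obtain s p e where 1: "appr x s p e" "p \<longlonglongrightarrow> k" using \<open>D' x k\<close> unfolding D'_def by blast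
    obtain t q d where 2: "appr y t q d" "q \<longlonglongrightarrow> l" using \<open>D' y l\<close> unfolding D'_def by blast
    have "small (x + y - (s n + t n)) (e n + d n)" for n
      using small_add[of "x - s n" "e n" "y - t n" "d n"] 1 2 
      by (simp add: appr_def algebra_simps)
    then have "appr (x + y) (\<lambda>n. s n + t n) (\<lambda>n. p n + q n) (\<lambda>n. e n + d n)"
      using 1 2 G_add tendsto_add[of e 0 sequentially d 0] by (simp add: appr_def)
    then show ?thesis using tendsto_add[OF 1(2) 2(2)] D'_def by blast
  qed
  have D'_scale: "D' (c *\<^sub>C x) (c *\<^sub>C l)" if xl: "D' x l" for c x l
  proof -
    obtain s p e where 1: "appr x s p e" "p \<longlonglongrightarrow> l" using xl unfolding D'_def by blast
    have "small (c *\<^sub>C x - c *\<^sub>C s n) (cmod c * e n)" for n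
      using small_scale[of "x - s n" "e n" c] 1 by (simp add: appr_def scaleC_diff_right)
    then have "appr (c *\<^sub>C x) (\<lambda>n. c *\<^sub>C s n) (\<lambda>n. c *\<^sub>C p n) (\<lambda>n. cmod c * e n)"
      using 1 G_scale tendsto_mult_right[of e 0 sequentially "cmod c"]
      by (simp add: appr_def tendsto_mult_right_zero)
    then show ?thesis using tendsto_scaleC[OF 1(2)] D'_def by blast
  qed
  have norm_le: "norm l \<le> sqrt (b x x) + \<bar>d\<bar>" if yl: "(y, l) \<in> G" and d: "small (x - y) d" for x y l d
  proof -
    \<comment> \<open>An approximate projection \<open>y\<close> of \<open>x\<close> is hardly
      longer than \<open>x\<close>: split b y y, estimate the two terms by Cauchy-Schwarz and by
      \<open>small\<close>, and cancel one factor sqrt (b y y).\<close>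
    have "sqrt (b y y) * sqrt (b y y) = b x y - b (x - y) y"
      using b_nonneg[of y] by (simp add: b_diff)
    also have "\<dots> \<le> sqrt (b x x) * sqrt (b y y) + d * sqrt (b y y)"
      using CS[of x y] d yl by (fastforce simp: small_def)
    also have "\<dots> \<le> sqrt (b x x) * sqrt (b y y) + \<bar>d\<bar> * sqrt (b y y)"
      using b_nonneg[of y] by (simp add: mult_right_mono)
    also have "\<dots> = (sqrt (b x x) + \<bar>d\<bar>) * sqrt (b y y)"
      by (simp add: algebra_simps)
    finally have *: "sqrt (b y y) * sqrt (b y y) \<le> (sqrt (b x x) + \<bar>d\<bar>) * sqrt (b y y)" .
    have "sqrt (b y y) \<le> sqrt (b x x) + \<bar>d\<bar>"
    proof (cases "sqrt (b y y) > 0")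
      case True
      then show ?thesis using * mult_le_cancel_right_pos by blast
    next
      case False
      then show ?thesis using real_sqrt_ge_zero[OF b_nonneg[of x]] by linarith
    qed
    then show ?thesis using norm_G[OF yl] by linarith
  qed
  have D'_norm: "norm l \<le> sqrt (b x x)" if xl: "D' x l" for x l
  proof -
    obtain s p e where 1: "appr x s p e" "p \<longlonglongrightarrow> l" using xl unfolding D'_def by blast
    have "(\<lambda>n. sqrt (b x x) + \<bar>e n\<bar>) \<longlonglongrightarrow> sqrt (b x x) + \<bar>0\<bar>"
      using 1 by (intro tendsto_intros) (simp add: appr_def)
    moreover have "norm (p n) \<le> sqrt (b x x) + \<bar>e n\<bar>" for n
      using norm_le[of "s n" "p n" x "e n"] 1 by (simp add: appr_def)
    ultimately show ?thesis
      using LIMSEQ_le[OF tendsto_norm[OF 1(2)]] by fastforce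
  qed
  have D'_unique: "k = l" if "D' x k" "D' x l" for x k l
  proof -
    \<comment> \<open>The difference of two values at \<open>x\<close> is a value at 0, where the
      norm bound is 0. So independence of the approximating sequence follows from linearity and the
      bound.\<close>
    have "D' (x + (-1) *\<^sub>C x) (k + (-1) *\<^sub>C l)"
      using D'_add[OF that(1) D'_scale[OF that(2)]] .
    then have "norm (k - l) \<le> sqrt (b 0 0)"
      using D'_norm by (simp add: scaleC_minus_one)
    then show ?thesis using b_scaleR[of 0 0 0] by simp
  qed
  have D'_G: "D' x k" if "(x, k) \<in> G" for x k
  proof -
    have "appr x (\<lambda>_. x) (\<lambda>_. k) (\<lambda>_. 0)"
      using that b_scaleR[of 0 0] by (simp add: appr_def small_def)
    then show ?thesis unfolding D'_def using tendsto_const by blast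
  qed
  have D'_closure: "l \<in> closure (snd ` G)" if xl: "D' x l" for x l
  proof -
    obtain s p e where 1: "appr x s p e" "p \<longlonglongrightarrow> l" using xl unfolding D'_def by blast
    then have "p n \<in> snd ` G" for n by (force simp: appr_def)
    then show ?thesis using 1 closure_sequential by blast
  qed
  have D'_ex: "\<exists>l. D' x l" for x
  proof -
    \<comment> \<open>The squared seminorm distance from \<open>x\<close> to a point of the domain;
      a minimising sequence for it supplies the approximate projections.\<close>
    define q where "q = (\<lambda>(s, k::'k). b (x - s) (x - s))"
    define d where "d = Inf (q ` G)"
    have bdd: "bdd_below (q ` G)"
      by (rule bdd_belowI[of _ 0]) (auto simp: q_def b_nonneg)
    have d_le: "d \<le> b (x - s) (x - s)" if "(s, k) \<in> G" for s k
      using cINF_lower[OF bdd that] by (simp add: d_def q_def)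
    have "\<exists>g. g \<in> G \<and> q g < d + 1 / real (Suc n)" for n
    proof -
      have "d < d + 1 / real (Suc n)" by simp
      then show ?thesis
        unfolding d_def using G0 bdd
        by (subst (asm) cInf_less_iff) auto
    qed
    then obtain g where g: "\<And>n. g n \<in> G" "\<And>n. q (g n) < d + 1 / real (Suc n)"
      by metis
    define s where "s n = fst (g n)" for n
    define p where "p n = snd (g n)" for n
    \<comment> \<open>The excess over the infimum \<open>d\<close> is below 1 / (n + 1), and the
      discriminant inequality takes its square root.\<close>
    define e where "e n = sqrt (1 / real (Suc n))" for n
    have sp: "(s n, p n) \<in> G" for n using g by (simp add: s_def p_def)
    have e0: "e \<longlonglongrightarrow> 0"
      using tendsto_real_sqrt[OF LIMSEQ_inverse_real_of_nat]
      by (simp add: e_def[abs_def] inverse_eq_divide)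
    have "small (x - s n) (e n)" for n
      unfolding small_def
    proof clarify
      fix y l assume yl: "(y, l) \<in> G"
      define u where "u = x - s n"
      have qu: "b u u - d \<le> 1 / real (Suc n)"
        using g(2)[of n] by (simp add: q_def u_def s_def case_prod_beta)
      have "\<bar>b u y\<bar> \<le> sqrt (b u u - d) * sqrt (b y y)"
      proof (rule quadratic_nonneg_imp_discriminant)
        fix t :: real
        \<comment> \<open>Moving \<open>s n\<close> along the domain gives another competitor for
          the infimum, so the quadratic in \<open>t\<close> with constant term b u u - d is
          nonnegative.\<close>
        have "(s n - t *\<^sub>R y, p n - t *\<^sub>R l) \<in> G"
          using G_diff[OF sp G_scale[OF yl]] by (simp add: scaleR_eq_scaleC)
        from d_le[OF this] have "d \<le> b (u + t *\<^sub>R y) (u + t *\<^sub>R y)"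
          by (simp add: u_def algebra_simps)
        then show "0 \<le> b u u - d + 2 * t * b u y + t\<^sup>2 * b y y"
          using b_sym[of y u]
          by (simp add: b_add b_add2 b_scaleR b_scaleR2 power2_eq_square algebra_simps)
      qed (rule b_nonneg)
      also have "\<dots> \<le> e n * sqrt (b y y)"
        using qu b_nonneg[of y] unfolding e_def by (intro mult_right_mono) auto
      finally show "\<bar>b (x - s n) y\<bar> \<le> e n * sqrt (b y y)" by (simp add: u_def)
    qed
    then have appr: "appr x s p e" using sp e0 by (simp add: appr_def)
    have norm_diff: "norm (p m - p n) \<le> \<bar>e m\<bar> + \<bar>e n\<bar>" for m n
    proof -
      \<comment> \<open>Two nearly orthogonal remainders of the same \<open>x\<close> make s m - s n
        an approximate projection of 0, so its image under the relation has small norm.\<close>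
      have "small ((x - s m) - (x - s n)) (e m + e n)"
        using appr by (intro small_diff) (simp_all add: appr_def)
      then have "small (0 - (s m - s n)) (e m + e n)" by (simp add: algebra_simps)
      from norm_le[OF G_diff[OF sp sp] this]
      have "norm (p m - p n) \<le> sqrt (b 0 0) + \<bar>e m + e n\<bar>" .
      then show ?thesis using b_scaleR[of 0 0 0] by simp
    qed
    have "Cauchy p"
    proof (rule metric_CauchyI)
      fix r :: real assume "0 < r"
      then obtain N where N: "\<And>n. n \<ge> N \<Longrightarrow> \<bar>e n\<bar> < r / 2"
        using LIMSEQ_D[OF e0, of "r / 2"] by auto
      have "dist (p m) (p n) < r" if "m \<ge> N" "n \<ge> N" for m n
        using norm_diff[of m n] N[OF that(1)] N[OF that(2)] by (simp add: dist_norm)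
      then show "\<exists>M. \<forall>m\<ge>M. \<forall>n\<ge>M. dist (p m) (p n) < r" by blast
    qed
    then obtain l where "p \<longlonglongrightarrow> l" using Cauchy_convergent convergent_def by blast
    then show ?thesis using appr D'_def by blast
  qed
  define D where "D x = (SOME l. D' x l)" for x
  have D: "D' x (D x)" for x unfolding D_def using someI_ex[OF D'_ex] .
  show thesis
  proof (rule that)
    show "D (x + y) = D x + D y" for x y by (rule D'_unique[OF D D'_add[OF D D]])
    show "D (c *\<^sub>C x) = c *\<^sub>C D x" for c x by (rule D'_unique[OF D D'_scale[OF D]])
    show "(norm (D x))\<^sup>2 \<le> b x x" for x
      using power_mono[OF D'_norm[OF D, of x] norm_ge_zero, of 2] b_nonneg[of x] by simp
    show "D x = k" if "(x, k) \<in> G" for x k by (rule D'_unique[OF D D'_G[OF that]])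
    show "D x \<in> closure (snd ` G)" for x by (rule D'_closure[OF D])
  qed
qed

section \<open>Orthogonal projections and adjoints\<close>

text \<open>The identity of \<open>S\<close> extends to a contraction \<open>D\<close> of the whole
  space with values in the closure of \<open>S\<close>, which is \<open>S\<close>. A contractive
  idempotent is the orthogonal projection onto its range.\<close>

lemma orth_proj_exists:
  fixes S :: "'a::complex_hilbert_space set"
  assumes S: "closed_csubspace S"
  shows "\<exists>y\<in>S. \<forall>z\<in>S. cinner (x - y) z = 0"
proof -
  note SD = closed_csubspaceD[OF S]
  obtain D :: "'a \<Rightarrow> 'a" where D:
    "\<And>x y. D (x + y) = D x + D y" "\<And>c x. D (c *\<^sub>C x) = c *\<^sub>C D x"
    "\<And>x. (norm (D x))\<^sup>2 \<le> inner x x" "\<And>x k. (x, k) \<in> (\<lambda>s. (s, s)) ` S \<Longrightarrow> D x = k"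
    "\<And>x. D x \<in> closure (snd ` (\<lambda>s. (s, s)) ` S)"
    by (rule form_contraction_extension[of inner "(\<lambda>s. (s, s)) ` S"])
      (auto simp: inner_add_left inner_scaleC_left SD power2_norm_eq_inner intro: inner_commute)
  have D_in: "D x \<in> S" for x
    using D(5)[of x] SD(5) by (simp add: image_image)
  have D_id: "D s = s" if "s \<in> S" for s using D(4) that by blast
  define u where "u = x - D x"
  have Du: "D u = 0"
    using D(1)[of u "D x"] D_id[OF D_in] by (simp add: u_def)
  have *: "inner u z = 0" if z: "z \<in> S" for z
  proof -
    have "\<bar>inner u z\<bar> \<le> sqrt 0 * sqrt (inner u u)"
    proof (rule quadratic_nonneg_imp_discriminant)
      fix t :: real
      \<comment> \<open>As \<open>D\<close> kills \<open>u\<close> and fixes \<open>z\<close>,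
        contractivity gives |z| \<le> |z + t u| for all real \<open>t\<close>; the discriminant with
        \<open>a = 0\<close> then forces orthogonality.\<close>
      have "D (z + t *\<^sub>R u) = z" using D_id[OF z] Du by (simp add: D scaleR_eq_scaleC)
      with D(3)[of "z + t *\<^sub>R u"] have "inner z z \<le> inner (z + t *\<^sub>R u) (z + t *\<^sub>R u)"
        by (simp add: power2_norm_eq_inner)
      then show "0 \<le> 0 + 2 * t * inner u z + t\<^sup>2 * inner u u"
        by (simp add: inner_add_left inner_add_right inner_commute power2_eq_square
            algebra_simps)
    qed simp
    then show ?thesis by simp
  qed
  have "cinner u z = 0" if "z \<in> S" for z
    unfolding cinner_eq_zero_iff_inner inner_scaleC_left using * SD(3) that by blast
  then show ?thesis using D_in u_def by blast
qed

lemma orth_proj_eqI: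
  assumes "closed_csubspace S" "y \<in> S" "\<And>z. z \<in> S \<Longrightarrow> cinner (x - y) z = 0"
  shows "orth_proj S x = y"
  unfolding orth_proj_def
proof (rule the_equality)
  fix w assume w: "w \<in> S \<and> (\<forall>z\<in>S. cinner (x - w) z = 0)"
  have "w - y \<in> S" using assms w closed_csubspaceD(4) by blast
  then have "cinner ((x - y) - (x - w)) (w - y) = 0"
    using assms w by (simp only: cinner_diff_left) simp
  then show "w = y" by (simp add: cinner_self)
qed (use assms in blast)

context
  fixes S :: "'a::complex_hilbert_space set"
  assumes S: "closed_csubspace S"
begin

lemma orth_proj_in: "orth_proj S x \<in> S"
  and cinner_diff_orth_proj: "z \<in> S \<Longrightarrow> cinner (x - orth_proj S x) z = 0"
proof -
  obtain y where y: "y \<in> S" "\<forall>z\<in>S. cinner (x - y) z = 0"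
    using orth_proj_exists[OF S] by blast
  then have "orth_proj S x = y" using orth_proj_eqI[OF S] by blast
  then show "orth_proj S x \<in> S" "z \<in> S \<Longrightarrow> cinner (x - orth_proj S x) z = 0"
    using y by auto
qed

lemma orth_proj_id: "x \<in> S \<Longrightarrow> orth_proj S x = x"
  by (rule orth_proj_eqI[OF S]) auto

lemma orth_proj_add: "orth_proj S (x + y) = orth_proj S x + orth_proj S y"
proof (rule orth_proj_eqI[OF S])
  show "cinner (x + y - (orth_proj S x + orth_proj S y)) z = 0" if "z \<in> S" for z
    unfolding add_diff_add using that by (simp add: cinner_add_left cinner_diff_orth_proj)
qed (simp add: closed_csubspaceD[OF S] orth_proj_in)

lemma orth_proj_scaleC: "orth_proj S (c *\<^sub>C x) = c *\<^sub>C orth_proj S x"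
proof (rule orth_proj_eqI[OF S])
  show "cinner (c *\<^sub>C x - c *\<^sub>C orth_proj S x) z = 0" if "z \<in> S" for z
    unfolding scaleC_diff_right[symmetric] using that
    by (simp add: cinner_scaleC_left cinner_diff_orth_proj)
qed (simp add: closed_csubspaceD[OF S] orth_proj_in)

lemma norm_orth_proj_Pythagoras:
  "(norm x)\<^sup>2 = (norm (orth_proj S x))\<^sup>2 + (norm (x - orth_proj S x))\<^sup>2"
proof -
  have "inner (x - orth_proj S x) (orth_proj S x) = 0"
    using cinner_diff_orth_proj[OF orth_proj_in] cinner_imp_inner_eq_zero by blast
  then show ?thesis
    unfolding power2_norm_eq_inner by (simp add: inner_diff_left inner_diff_right inner_commute)
qed

lemma norm_orth_proj_le: "norm (orth_proj S x) \<le> norm x"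
  by (rule power2_le_imp_le) (simp_all add: norm_orth_proj_Pythagoras[of x])

lemma orth_proj_in_bdd_ops: "orth_proj S \<in> bdd_ops UNIV S"
  by (rule bdd_opsI[of _ _ _ 1])
    (auto simp: orth_proj_in orth_proj_add orth_proj_scaleC norm_orth_proj_le)

lemma orth_proj_diff: "orth_proj S (x - y) = orth_proj S x - orth_proj S y"
  using orth_proj_add[of "x - y" y] by simp

lemma orth_proj_eq_zeroI: "(\<And>z. z \<in> S \<Longrightarrow> cinner x z = 0) \<Longrightarrow> orth_proj S x = 0"
  by (rule orth_proj_eqI[OF S]) (auto simp: closed_csubspaceD[OF S])

lemma orth_proj_orth_proj_superset:
  assumes S': "closed_csubspace S'" "S \<subseteq> S'"
  shows "orth_proj S (orth_proj S' x) = orth_proj S x"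
proof -
  have "orth_proj S (x - orth_proj S' x) = 0"
  proof (rule orth_proj_eq_zeroI)
    fix z assume "z \<in> S"
    obtain y where y: "y \<in> S'" "\<forall>z\<in>S'. cinner (x - y) z = 0"
      using orth_proj_exists[OF S'(1)] by blast
    then have "orth_proj S' x = y" using orth_proj_eqI[OF S'(1)] by blast
    then show "cinner (x - orth_proj S' x) z = 0" using y \<open>z \<in> S\<close> S' by blast
  qed
  then show ?thesis by (simp add: orth_proj_diff)
qed

end

text \<open>For \<open>f\<close> not zero, the kernel has a one-dimensional complement, spanned by
  the remainder \<open>u\<close> of any vector outside the kernel; \<open>f\<close> is determined by
  its value at \<open>u\<close>.\<close>

lemma riesz_representation:
  fixes f :: "'a::complex_hilbert_space \<Rightarrow> complex"
  assumes f: "f \<in> bdd_ops UNIV UNIV"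
  shows "\<exists>z. \<forall>x. f x = cinner x z"
proof (cases "\<forall>x. f x = 0")
  case True
  then show ?thesis by (intro exI[of _ 0]) simp
next
  case False
  then obtain a where a: "f a \<noteq> 0" by blast
  interpret f: bounded_linear f using bdd_ops_imp_bounded_linear[OF f] .
  have fscale: "f (c *\<^sub>C x) = c * f x" for c x
    using bdd_opsD(3)[OF f] by (simp add: scaleC_complex_def)
  define N where "N = f -` {0}"
  have N: "closed_csubspace N"
    unfolding closed_csubspace_def N_def
    using continuous_closed_vimage[of "{0}" f]
    by (auto simp: f.add fscale f.continuous_on[OF continuous_on_id] f.isCont)
  define u where "u = a - orth_proj N a"
  have fu: "f u \<noteq> 0"
    using a orth_proj_in[OF N, of a] by (simp add: u_def f.diff N_def)
  have u0: "u \<noteq> 0" using fu by auto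
  \<comment> \<open>Scaled so that cinner u z = f u; the conjugate is due to conjugate-linearity in
    the second argument.\<close>
  define z where "z = (cnj (f u) / (norm u)\<^sup>2) *\<^sub>C u"
  have "f x = cinner x z" for x
  proof -
    have "x - (f x / f u) *\<^sub>C u \<in> N" using fu by (simp add: N_def f.diff fscale)
    then have "cinner (x - (f x / f u) *\<^sub>C u) u = 0"
      using cinner_diff_orth_proj[OF N] cinner_eq_zero_commute u_def by metis
    then have "cinner x u = f x / f u * (norm u)\<^sup>2"
      by (simp add: cinner_diff_left cinner_scaleC_left cinner_self)
    then show ?thesis using fu u0 by (simp add: z_def cinner_scaleC_right)
  qed
  then show ?thesis by blast
qed

text \<open>The Riesz vector of x \<mapsto> cinner (T x) y is the one that the definite description
  in \<open>adj_on\<close> selects. Through this, the adjoint relations of an isometric lifting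
  become inner product identities.\<close>

lemma cinner_adj_on_UNIV:
  fixes T :: "'a::complex_hilbert_space \<Rightarrow> 'b::complex_inner_space"
  assumes T: "T \<in> bdd_ops UNIV UNIV"
  shows "cinner (T x) y = cinner x (adj_on UNIV T y)"
proof -
  interpret T: bounded_linear T using bdd_ops_imp_bounded_linear[OF T] .
  obtain M where M: "\<And>x. norm (T x) \<le> norm x * M" using T.bounded by blast
  have CS: "cmod (cinner u v) \<le> norm u * norm v" for u v :: 'b
  proof (cases "cinner u v = 0")
    case False
    \<comment> \<open>A unimodular rotation makes the complex product real and nonnegative, which
      reduces the complex Cauchy-Schwarz inequality to the real one.\<close>
    define c where "c = cnj (sgn (cinner u v))"
    have "c * cinner u v = cmod (cinner u v)"
      using False by (simp add: c_def sgn_eq complex_norm_square[symmetric] power2_eq_square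
          mult.commute[of "cnj _"])
    then have "cmod (cinner u v) = inner (c *\<^sub>C u) v"
      by (simp add: inner_eq_Re_cinner cinner_scaleC_left)
    also have "\<dots> \<le> norm (c *\<^sub>C u) * norm v" by (rule norm_cauchy_schwarz)
    also have "\<dots> = norm u * norm v"
      using False by (simp add: norm_scaleC c_def norm_sgn)
    finally show ?thesis .
  qed simp
  have "(\<lambda>x. cinner (T x) y) \<in> bdd_ops UNIV UNIV"
  proof (rule bdd_opsI[of _ _ _ "M * norm y"])
    fix x
    have "cmod (cinner (T x) y) \<le> norm (T x) * norm y" by (rule CS)
    also have "\<dots> \<le> (norm x * M) * norm y" by (intro mult_right_mono M) simp
    finally show "cmod (cinner (T x) y) \<le> M * norm y * norm x" by (simp add: algebra_simps)
  qed (auto simp: bdd_opsD[OF T] cinner_add_left cinner_scaleC_left scaleC_complex_def)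
  then obtain z where z: "\<And>x. cinner (T x) y = cinner x z"
    using riesz_representation by blast
  have "adj_on UNIV T y = z"
    unfolding adj_on_def
  proof (rule the_equality)
    fix w assume "w \<in> UNIV \<and> (\<forall>x\<in>UNIV. cinner (T x) y = cinner x w)"
    then have "cinner (w - z) (w - z) = 0" using z by (simp add: cinner_diff_right)
    then show "w = z" by (simp add: cinner_self)
  qed (use z in simp)
  then show ?thesis using z by simp
qed

section \<open>Parrott's lemma\<close>

(* The missing row of B extends k - A x, on G, to a contraction with respect to the defect form
   c^2 |x|^2 - |A x|^2. *)
lemma parrott:
  fixes A :: "'x::complex_inner_space \<Rightarrow> 'k::complex_hilbert_space"
  assumes H: "closed_csubspace H" and A: "A \<in> bdd_ops UNIV H"
    and A_le: "\<And>x. norm (A x) \<le> c * norm x"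
    and G0: "(0, 0) \<in> G"
    and G_add: "\<And>x k y l. (x, k) \<in> G \<Longrightarrow> (y, l) \<in> G \<Longrightarrow> (x + y, k + l) \<in> G"
    and G_scale: "\<And>a x k. (x, k) \<in> G \<Longrightarrow> (a *\<^sub>C x, a *\<^sub>C k) \<in> G"
    and G_le: "\<And>x k. (x, k) \<in> G \<Longrightarrow> norm k \<le> c * norm x"
    and G_proj: "\<And>x k. (x, k) \<in> G \<Longrightarrow> orth_proj H k = A x"
  obtains B where "B \<in> bdd_ops UNIV UNIV" "\<And>x. norm (B x) \<le> c * norm x"
    "\<And>x. orth_proj H (B x) = A x" "\<And>x k. (x, k) \<in> G \<Longrightarrow> B x = k"
proof -
  interpret A: bounded_linear A using bdd_ops_imp_bounded_linear[OF A] .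
  note AD = bdd_opsD[OF A]
  define b where "b x y = c\<^sup>2 * inner x y - inner (A x) (A y)" for x y
  define G' where "G' = {(x, k - A x) | x k. (x, k) \<in> G}"
  have b_self: "b x x = (c * norm x)\<^sup>2 - (norm (A x))\<^sup>2" for x
    by (simp add: b_def power_mult_distrib power2_norm_eq_inner)
  have nn: "0 \<le> c * norm x" for x :: 'x using A_le[of x] norm_ge_zero order_trans by blast
  obtain D where D: "\<And>x y. D (x + y) = D x + D y" "\<And>a x. D (a *\<^sub>C x) = a *\<^sub>C D x"
    "\<And>x. (norm (D x))\<^sup>2 \<le> b x x" "\<And>x k. (x, k) \<in> G' \<Longrightarrow> D x = k"
    "\<And>x. D x \<in> closure (snd ` G')"
  proof (rule form_contraction_extension[of b G'])
    show "b (x + y) z = b x z + b y z" for x y z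
      by (simp add: b_def A.add inner_add_left algebra_simps)
    show "b x y = b y x" for x y by (simp add: b_def inner_commute)
    show "b (a *\<^sub>C x) y = b x (cnj a *\<^sub>C y)" for a x y
      by (simp add: b_def AD inner_scaleC_left)
    show "b (r *\<^sub>R x) y = r * b x y" for r x y
      by (simp add: b_def A.scaleR algebra_simps)
    show "0 \<le> b x x" for x using A_le[of x] by (simp add: b_self power_mono)
    show "(0, 0) \<in> G'" unfolding G'_def using G0 by force
    show "(x + y, k + l) \<in> G'" if xk: "(x, k) \<in> G'" and yl: "(y, l) \<in> G'" for x k y l
    proof -
      obtain k' l' where "(x, k') \<in> G" "k = k' - A x" "(y, l') \<in> G" "l = l' - A y"
        using xk yl by (auto simp: G'_def)
      then have "(x + y, k' + l') \<in> G" "k + l = k' + l' - A (x + y)"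
        using G_add by (auto simp: A.add)
      then show ?thesis unfolding G'_def by blast
    qed
    show "(a *\<^sub>C x, a *\<^sub>C k) \<in> G'" if xk: "(x, k) \<in> G'" for a x k
    proof -
      obtain k' where "(x, k') \<in> G" "k = k' - A x" using xk by (auto simp: G'_def)
      then have "(a *\<^sub>C x, a *\<^sub>C k') \<in> G" "a *\<^sub>C k = a *\<^sub>C k' - A (a *\<^sub>C x)"
        using G_scale by (auto simp: AD scaleC_diff_right)
      then show ?thesis unfolding G'_def by blast
    qed
    show "(norm k)\<^sup>2 \<le> b x x" if xk: "(x, k) \<in> G'" for x k
    proof -
      obtain k' where k': "(x, k') \<in> G" "k = k' - A x" using xk by (auto simp: G'_def)
      \<comment> \<open>Here \<open>k\<close> is the component of k' orthogonal to \<open>H\<close>,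
        so by Pythagoras its squared norm is |k'|^2 - |A x|^2.\<close>
      have "(norm k')\<^sup>2 \<le> (c * norm x)\<^sup>2" using G_le[OF k'(1)] by (simp add: power_mono)
      then show ?thesis
        using norm_orth_proj_Pythagoras[OF H, of k'] G_proj[OF k'(1)]
        by (simp add: b_self k'(2))
    qed
  qed blast
  \<comment> \<open>Subtracting the projection puts the second summand in the complement of
    \<open>H\<close>. On the domain of \<open>G\<close> it changes nothing, since k - A x is already
    orthogonal to \<open>H\<close>.\<close>
  define B where "B x = A x + (D x - orth_proj H (D x))" for x
  have proj: "orth_proj H (B x) = A x" for x
    by (simp add: B_def orth_proj_add[OF H] orth_proj_diff[OF H] orth_proj_id[OF H]
        orth_proj_in[OF H] AD)
  have le: "norm (B x) \<le> c * norm x" for x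
  proof (rule power2_le_imp_le)
    have "(norm (B x))\<^sup>2 = (norm (A x))\<^sup>2 + (norm (D x - orth_proj H (D x)))\<^sup>2"
      using norm_orth_proj_Pythagoras[OF H, of "B x"] by (simp add: proj) (simp add: B_def)
    also have "\<dots> \<le> (norm (A x))\<^sup>2 + (norm (D x))\<^sup>2"
      using norm_orth_proj_Pythagoras[OF H, of "D x"] by simp
    also have "\<dots> \<le> (c * norm x)\<^sup>2" using D(3)[of x] by (simp add: b_self)
    finally show "(norm (B x))\<^sup>2 \<le> (c * norm x)\<^sup>2" .
  qed (rule nn)
  have "B x = k" if "(x, k) \<in> G" for x k
  proof -
    have "D x = k - A x" using D(4) that by (auto simp: G'_def)
    then show ?thesis
      using G_proj[OF that] by (simp add: B_def orth_proj_diff[OF H] orth_proj_id[OF H] AD)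
  qed
  moreover have "B \<in> bdd_ops UNIV UNIV"
  proof (rule bdd_opsI[OF _ _ _ le])
    show "B (x + y) = B x + B y" for x y
      by (simp add: B_def A.add D orth_proj_add[OF H])
    show "B (a *\<^sub>C x) = a *\<^sub>C B x" for a x
      by (simp add: B_def AD D orth_proj_scaleC[OF H] scaleC_add_right scaleC_diff_right)
  qed simp
  ultimately show thesis using that le proj by blast
qed

section \<open>The lifting\<close>

lemma isometric_lifting_cinner:
  assumes "isometric_lifting n H T V" "i \<in> indices n" "j \<in> indices n"
  shows "cinner (V i x) (V j y) = (if i = j then cinner x y else 0)"
  using assms by (simp add: isometric_lifting_def cinner_adj_on_UNIV)

(* The spaces H_m: the complement of H_(m+1) is the closed span of the images of the complement of
   H_m under the V_i, which is the smallest possible choice and makes H_(m+1) a complement without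
   any use of adjoints. *)
primrec lifting_space ::
    "nat set \<Rightarrow> (nat \<Rightarrow> 'k \<Rightarrow> 'k) \<Rightarrow> 'k set \<Rightarrow> nat \<Rightarrow> 'k::complex_hilbert_space set"
  where "lifting_space I V H 0 = H"
  | "lifting_space I V H (Suc m) =
      {y. \<forall>i\<in>I. \<forall>x. (\<forall>h\<in>lifting_space I V H m. cinner x h = 0) \<longrightarrow> cinner (V i x) y = 0}"

lemma closed_csubspace_orthogonal:
  fixes S :: "'a::complex_inner_space set"
  shows "closed_csubspace {y. \<forall>x\<in>S. cinner x y = 0}"
proof -
  have "{y. \<forall>x\<in>S. cinner x y = 0} = (\<Inter>x\<in>S. {y. inner x y = 0} \<inter> {y. inner (\<i> *\<^sub>C x) y = 0})"
    by (auto simp: cinner_eq_zero_iff_inner)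
  then have "closed {y. \<forall>x\<in>S. cinner x y = 0}"
    by (auto intro!: closed_INT closed_Int closed_Collect_eq continuous_intros)
  then show ?thesis
    by (simp add: closed_csubspace_def cinner_add_right cinner_scaleC_right)
qed

section \<open>One extension step along the orthogonal subspaces\<close>

context
  fixes I :: "nat set" and V :: "nat \<Rightarrow> 'k::complex_hilbert_space \<Rightarrow> 'k"
  assumes V: "\<And>i. i \<in> I \<Longrightarrow> V i \<in> bdd_ops UNIV UNIV"
    and VV: "\<And>i j x y. i \<in> I \<Longrightarrow> j \<in> I \<Longrightarrow>
      cinner (V i x) (V j y) = (if i = j then cinner x y else 0)"
begin

lemma norm_isometry: "i \<in> I \<Longrightarrow> norm (V i x) = norm x"
  using VV[of i i x x] by (simp add: cinner_self flip: of_real_power)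

text \<open>\<open>compat\<close> says that the prescribed values project to \<open>A\<close>, which
  any lift taking these values must satisfy. Only finite sums of vectors from the \<open>X i\<close>
  enter, so an infinite index set raises no question of convergence.\<close>

lemma lifting_step:
  fixes X :: "nat \<Rightarrow> 'x::complex_hilbert_space set"
  assumes X: "\<And>i. i \<in> I \<Longrightarrow> closed_csubspace (X i)"
    and X_orth: "\<And>i j. i \<in> I \<Longrightarrow> j \<in> I \<Longrightarrow> i \<noteq> j \<Longrightarrow> orthogonal_sets (X i) (X j)"
    and R: "\<And>i. i \<in> I \<Longrightarrow> contraction_on (X i) (R i)"
    and S: "closed_csubspace S" and A: "A \<in> bdd_ops UNIV S"
    and c: "0 \<le> c" and A_le: "\<And>x. norm (A x) \<le> c * norm x"
    and compat: "\<And>i x. i \<in> I \<Longrightarrow> x \<in> X i \<Longrightarrow> orth_proj S (V i (A (R i x))) = A x"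
  obtains B where "B \<in> bdd_ops UNIV UNIV" "\<And>x. norm (B x) \<le> c * norm x"
    "\<And>x. orth_proj S (B x) = A x" "\<And>i x. i \<in> I \<Longrightarrow> x \<in> X i \<Longrightarrow> B x = V i (A (R i x))"
proof -
  interpret A: bounded_linear A using bdd_ops_imp_bounded_linear[OF A] .
  interpret P: bounded_linear "orth_proj S"
    using bdd_ops_imp_bounded_linear[OF orth_proj_in_bdd_ops[OF S]] .
  note AD = bdd_opsD[OF A] and XD = closed_csubspaceD[OF X] and VD = bdd_opsD[OF V]
  have R_ops: "R i \<in> bdd_ops (X i) UNIV" if "i \<in> I" for i
    using R[OF that] by (simp add: contraction_on_def)
  note RD = bdd_opsD[OF R_ops]
  define W where "W i x = V i (A (R i x))" for i x
  have W_add: "W i (x + y) = W i x + W i y" if "i \<in> I" "x \<in> X i" "y \<in> X i" for i x y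
    using that by (simp add: W_def RD A.add VD)
  have W_scale: "W i (a *\<^sub>C x) = a *\<^sub>C W i x" if "i \<in> I" "x \<in> X i" for i a x
    using that by (simp add: W_def RD AD VD)
  have W_0: "W i 0 = 0" if "i \<in> I" for i
    using W_scale[OF that XD(1)[OF that], of 0] by simp
  have W_le: "norm (W i x) \<le> c * norm x" if "i \<in> I" "x \<in> X i" for i x
  proof -
    have "norm (W i x) \<le> c * norm (R i x)" using that A_le by (simp add: W_def norm_isometry)
    also have "\<dots> \<le> c * norm x"
      using R that c by (intro mult_left_mono) (auto simp: contraction_on_def)
    finally show ?thesis .
  qed
  \<comment> \<open>The entries lie in \<open>X i\<close> for all indices and vanish outside
    \<open>F\<close>. So \<open>F\<close> can be enlarged without changing the sums, and two
    families can be added over a common index set.\<close>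
  define fam where "fam F x \<longleftrightarrow> finite F \<and> F \<subseteq> I \<and> (\<forall>i\<in>I. x i \<in> X i) \<and> (\<forall>i. i \<notin> F \<longrightarrow> x i = 0)"
    for F x
  \<comment> \<open>A relation, so that no well-definedness has to be shown beforehand:
    single-valuedness is a consequence of linearity and the norm bound.\<close>
  define G where "G = {(\<Sum>i\<in>F. x i, \<Sum>i\<in>F. W i (x i)) | F x. fam F x}"
  have fam_mono: "(\<Sum>i\<in>F. x i) = (\<Sum>i\<in>F'. x i)" "(\<Sum>i\<in>F. W i (x i)) = (\<Sum>i\<in>F'. W i (x i))"
    if "fam F x" "F \<subseteq> F'" "finite F'" "F' \<subseteq> I" for F F' x
    using that W_0 by (auto intro!: sum.mono_neutral_left simp: fam_def)
  obtain B where B: "B \<in> bdd_ops UNIV UNIV" "\<And>x. norm (B x) \<le> c * norm x"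
    "\<And>x. orth_proj S (B x) = A x" "\<And>x k. (x, k) \<in> G \<Longrightarrow> B x = k"
  proof (rule parrott[OF S A A_le])
    have "fam {} (\<lambda>_. 0)" using XD(1) by (simp add: fam_def)
    then show "(0, 0) \<in> G" unfolding G_def by force
    show "(x + y, k + l) \<in> G" if xk: "(x, k) \<in> G" and yl: "(y, l) \<in> G" for x k y l
    proof -
      obtain F u where u: "fam F u" "x = (\<Sum>i\<in>F. u i)" "k = (\<Sum>i\<in>F. W i (u i))"
        using xk unfolding G_def by blast
      obtain F' v where v: "fam F' v" "y = (\<Sum>i\<in>F'. v i)" "l = (\<Sum>i\<in>F'. W i (v i))"
        using yl unfolding G_def by blast
      define E where "E = F \<union> F'"
      have E: "finite E" "E \<subseteq> I" using u v by (auto simp: E_def fam_def)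
      have "x = (\<Sum>i\<in>E. u i)" "k = (\<Sum>i\<in>E. W i (u i))" "y = (\<Sum>i\<in>E. v i)" "l = (\<Sum>i\<in>E. W i (v i))"
        unfolding u v using fam_mono[OF u(1) _ E] fam_mono[OF v(1) _ E] by (auto simp: E_def)
      moreover have "W i (u i + v i) = W i (u i) + W i (v i)" if "i \<in> E" for i
        using W_add u v that E by (auto simp: fam_def)
      ultimately have "x + y = (\<Sum>i\<in>E. u i + v i)" "k + l = (\<Sum>i\<in>E. W i (u i + v i))"
        by (simp_all add: sum.distrib)
      moreover have "fam E (\<lambda>i. u i + v i)"
        using u v E XD(2) by (auto simp: fam_def E_def)
      ultimately show ?thesis unfolding G_def by blast
    qed
    show "(a *\<^sub>C x, a *\<^sub>C k) \<in> G" if xk: "(x, k) \<in> G" for a x k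
    proof -
      obtain F u where u: "fam F u" "x = (\<Sum>i\<in>F. u i)" "k = (\<Sum>i\<in>F. W i (u i))"
        using xk unfolding G_def by blast
      have "W i (a *\<^sub>C u i) = a *\<^sub>C W i (u i)" if "i \<in> F" for i
        using W_scale u that by (auto simp: fam_def)
      then have "a *\<^sub>C x = (\<Sum>i\<in>F. a *\<^sub>C u i)" "a *\<^sub>C k = (\<Sum>i\<in>F. W i (a *\<^sub>C u i))"
        by (simp_all add: u scaleC_sum_right)
      moreover have "fam F (\<lambda>i. a *\<^sub>C u i)"
        using u XD(3) by (auto simp: fam_def)
      ultimately show ?thesis unfolding G_def by blast
    qed
    show "norm k \<le> c * norm x" if xk: "(x, k) \<in> G" for x k
    proof (rule power2_le_imp_le)
      obtain F u where u: "fam F u" "x = (\<Sum>i\<in>F. u i)" "k = (\<Sum>i\<in>F. W i (u i))"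
        using xk unfolding G_def by blast
      have F: "finite F" "F \<subseteq> I" "\<And>i. i \<in> F \<Longrightarrow> u i \<in> X i" using u by (auto simp: fam_def)
      have "(norm k)\<^sup>2 = (\<Sum>i\<in>F. (norm (W i (u i)))\<^sup>2)"
        unfolding u using F VV
        by (intro norm_sum_Pythagorean)
          (auto simp: pairwise_def orthogonal_def W_def subset_iff intro!: cinner_imp_inner_eq_zero)
      also have "\<dots> \<le> (\<Sum>i\<in>F. (c * norm (u i))\<^sup>2)"
        using F W_le by (intro sum_mono power_mono) auto
      also have "\<dots> = c\<^sup>2 * (\<Sum>i\<in>F. (norm (u i))\<^sup>2)"
        by (simp add: power_mult_distrib sum_distrib_left)
      also have "(\<Sum>i\<in>F. (norm (u i))\<^sup>2) = (norm x)\<^sup>2"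
      proof -
        have "inner (u i) (u j) = 0" if "i \<in> F" "j \<in> F" "i \<noteq> j" for i j
          using X_orth[of i j] F that
          by (auto simp: orthogonal_sets_def intro!: cinner_imp_inner_eq_zero)
        then show ?thesis
          unfolding u using F
          by (intro norm_sum_Pythagorean[symmetric]) (auto simp: pairwise_def orthogonal_def)
      qed
      finally show "(norm k)\<^sup>2 \<le> (c * norm x)\<^sup>2" by (simp add: power_mult_distrib)
    qed (simp add: c)
    show "orth_proj S k = A x" if xk: "(x, k) \<in> G" for x k
    proof -
      obtain F u where u: "fam F u" "x = (\<Sum>i\<in>F. u i)" "k = (\<Sum>i\<in>F. W i (u i))"
        using xk unfolding G_def by blast
      have "orth_proj S k = (\<Sum>i\<in>F. orth_proj S (W i (u i)))" by (simp add: u P.sum)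
      also have "\<dots> = (\<Sum>i\<in>F. A (u i))"
        using u compat by (intro sum.cong) (auto simp: fam_def W_def)
      finally show ?thesis by (simp add: u A.sum)
    qed
  qed blast
  have "B x = V i (A (R i x))" if i: "i \<in> I" "x \<in> X i" for i x
  proof (rule B(4))
    have "fam {i} ((\<lambda>_. 0)(i := x))" using i XD(1) by (auto simp: fam_def)
    then show "(x, V i (A (R i x))) \<in> G" unfolding G_def W_def by force
  qed
  then show thesis using that B by blast
qed

section \<open>The chain of subspaces and the limit of the successive lifts\<close>

context
  fixes H :: "'k set"
  assumes H: "closed_csubspace H"
    and V_orth: "\<And>i x h. i \<in> I \<Longrightarrow> (\<And>h. h \<in> H \<Longrightarrow> cinner x h = 0) \<Longrightarrow> h \<in> H \<Longrightarrow> cinner (V i x) h = 0"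
begin

lemma closed_csubspace_lifting_space: "closed_csubspace (lifting_space I V H m)"
proof (cases m)
  case 0
  then show ?thesis using H by simp
next
  case (Suc k)
  define Y where "Y = {V i x | i x. i \<in> I \<and> (\<forall>h\<in>lifting_space I V H k. cinner x h = 0)}"
  have "lifting_space I V H m = {y. \<forall>x\<in>Y. cinner x y = 0}"
    unfolding Suc Y_def by auto
  then show ?thesis by (simp only: closed_csubspace_orthogonal)
qed

text \<open>The start is \<open>V_orth\<close>: each \<open>V i\<close> maps the complement of
  \<open>H\<close> into itself. After that, a larger space has a smaller complement and hence
  imposes fewer conditions on the next space.\<close>

lemma lifting_space_Suc_superset: "lifting_space I V H m \<subseteq> lifting_space I V H (Suc m)"
proof (induction m)
  case 0
  then show ?case using V_orth by auto
next
  case (Suc m)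
  have mem: "y \<in> lifting_space I V H (Suc k) \<longleftrightarrow>
      (\<forall>i\<in>I. \<forall>x. (\<forall>h\<in>lifting_space I V H k. cinner x h = 0) \<longrightarrow> cinner (V i x) y = 0)" for y k
    by simp
  show ?case
  proof
    fix y assume "y \<in> lifting_space I V H (Suc m)"
    then show "y \<in> lifting_space I V H (Suc (Suc m))"
      unfolding mem[of y "Suc m"] mem[of y m] using Suc.IH by blast
  qed
qed

text \<open>For \<open>x\<close> in the complement of the space at stage \<open>m\<close>, cinner (V
  j x) (V i y) is either 0 or cinner x y, and the latter vanishes too.\<close>

lemma isometry_in_lifting_space:
  assumes "i \<in> I" "y \<in> lifting_space I V H m"
  shows "V i y \<in> lifting_space I V H (Suc m)"
  using assms VV by auto

lemma lifting_exists:
  fixes X :: "nat \<Rightarrow> 'x::complex_hilbert_space set"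
  assumes X: "\<And>i. i \<in> I \<Longrightarrow> closed_csubspace (X i)"
    and X_orth: "\<And>i j. i \<in> I \<Longrightarrow> j \<in> I \<Longrightarrow> i \<noteq> j \<Longrightarrow> orthogonal_sets (X i) (X j)"
    and R: "\<And>i. i \<in> I \<Longrightarrow> contraction_on (X i) (R i)"
    and A: "A \<in> bdd_ops UNIV H"
    and c: "0 \<le> c" and A_le: "\<And>x. norm (A x) \<le> c * norm x"
    and compat: "\<And>i x. i \<in> I \<Longrightarrow> x \<in> X i \<Longrightarrow> orth_proj H (V i (A (R i x))) = A x"
  obtains B where "B \<in> bdd_ops UNIV UNIV" "\<And>x. norm (B x) \<le> c * norm x"
    "\<And>x. orth_proj H (B x) = A x" "\<And>i x. i \<in> I \<Longrightarrow> x \<in> X i \<Longrightarrow> V i (B (R i x)) = B x"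
proof -
  define L where "L = lifting_space I V H"
  define P where "P m = orth_proj (L m)" for m
  have L: "closed_csubspace (L m)" for m unfolding L_def by (rule closed_csubspace_lifting_space)
  have L_Suc: "L m \<subseteq> L (Suc m)" for m unfolding L_def by (rule lifting_space_Suc_superset)
  have VL: "V i y \<in> L (Suc m)" if "i \<in> I" "y \<in> L m" for i y m
    using that unfolding L_def by (rule isometry_in_lifting_space)
  define good where "good m B \<longleftrightarrow> B \<in> bdd_ops UNIV (L m) \<and> (\<forall>x. norm (B x) \<le> c * norm x) \<and>
      (\<forall>i\<in>I. \<forall>x\<in>X i. P m (V i (B (R i x))) = B x)" for m and B :: "'x \<Rightarrow> 'k"
  \<comment> \<open>\<open>good\<close> holds the relation only after projection. The second clause
    here relates consecutive lifts exactly, so that no projection is left in the limit.\<close>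
  define succ where "succ m A' B \<longleftrightarrow> (\<forall>x. P m (B x) = A' x) \<and>
      (\<forall>i\<in>I. \<forall>x\<in>X i. B x = V i (A' (R i x)))" for m and A' B :: "'x \<Rightarrow> 'k"
  have "\<exists>F. \<forall>m. (good m (F m) \<and> (m = 0 \<longrightarrow> F m = A)) \<and> succ m (F m) (F (Suc m))"
  proof (rule dependent_nat_choice)
    show "\<exists>B. good 0 B \<and> (0 = 0 \<longrightarrow> B = A)"
      using A A_le compat by (intro exI[of _ A]) (simp add: good_def L_def P_def)
  next
    fix A' m assume "good m A' \<and> (m = 0 \<longrightarrow> A' = A)"
    then have A': "A' \<in> bdd_ops UNIV (L m)" "\<And>x. norm (A' x) \<le> c * norm x"
      "\<And>i x. i \<in> I \<Longrightarrow> x \<in> X i \<Longrightarrow> orth_proj (L m) (V i (A' (R i x))) = A' x"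
      by (auto simp: good_def P_def)
    obtain B where B: "B \<in> bdd_ops UNIV UNIV" "\<And>x. norm (B x) \<le> c * norm x"
      "\<And>x. orth_proj (L m) (B x) = A' x"
      "\<And>i x. i \<in> I \<Longrightarrow> x \<in> X i \<Longrightarrow> B x = V i (A' (R i x))"
      using lifting_step[OF X X_orth R L A'(1) c A'(2,3)] by blast
    \<comment> \<open>Parrott's lemma gives values in the whole space. Compressing them to the next
      space keeps their projection to stage \<open>m\<close>, and also the prescribed values, which
      already lie in that next space.\<close>
    define C where "C x = P (Suc m) (B x)" for x
    have PC: "P m (C x) = A' x" for x
      using orth_proj_orth_proj_superset[OF L L L_Suc] by (simp add: C_def P_def B)
    have C_X: "C x = V i (A' (R i x))" if "i \<in> I" "x \<in> X i" for i x
      using that B(4) VL bdd_opsD(1)[OF A'(1)] by (simp add: C_def P_def orth_proj_id[OF L])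
    have "P (Suc m) (V i (C (R i x))) = C x" if i: "i \<in> I" and x: "x \<in> X i" for i x
    proof -
      \<comment> \<open>The unknown part of C (R i x): it lies in the complement of stage
        \<open>m\<close>, so \<open>V i\<close> sends it into the complement of stage m + 1, where
        the projection removes it.\<close>
      define d where "d = C (R i x) - A' (R i x)"
      have "cinner d h = 0" if "h \<in> L m" for h
        using cinner_diff_orth_proj[OF L that, of "C (R i x)"] PC by (simp add: d_def P_def)
      then have "P (Suc m) (V i d) = 0"
        unfolding P_def using i by (intro orth_proj_eq_zeroI[OF L]) (auto simp: L_def)
      moreover have "V i (C (R i x)) = V i d + V i (A' (R i x))"
        using bdd_opsD(2)[OF V[OF i], of d "A' (R i x)"] by (simp add: d_def)
      ultimately have "P (Suc m) (V i (C (R i x))) = P (Suc m) (V i (A' (R i x)))"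
        by (simp add: P_def orth_proj_add[OF L])
      also have "\<dots> = C x"
        using C_X[OF i x] VL[OF i] bdd_opsD(1)[OF A'(1)] by (simp add: P_def orth_proj_id[OF L])
      finally show ?thesis .
    qed
    moreover have "norm (C x) \<le> c * norm x" for x
      using norm_orth_proj_le[OF L] B(2) order_trans unfolding C_def P_def by blast
    moreover from this have "C \<in> bdd_ops UNIV (L (Suc m))"
      by (intro bdd_opsI[of _ _ _ c])
        (auto simp: C_def P_def orth_proj_in[OF L] orth_proj_add[OF L] orth_proj_scaleC[OF L]
          bdd_opsD[OF B(1)])
    ultimately have "good (Suc m) C" by (simp add: good_def)
    then show "\<exists>B. (good (Suc m) B \<and> (Suc m = 0 \<longrightarrow> B = A)) \<and> succ m A' B"
      using PC C_X by (auto simp: succ_def)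
  qed
  then obtain F where "\<forall>m. (good m (F m) \<and> (m = 0 \<longrightarrow> F m = A)) \<and> succ m (F m) (F (Suc m))" ..
  then have F: "good m (F m)" "F 0 = A" "succ m (F m) (F (Suc m))" for m by simp_all
  have F_ops: "F m \<in> bdd_ops UNIV (L m)" and F_le: "norm (F m x) \<le> c * norm x" for m x
    using F(1) by (auto simp: good_def)
  have P_F: "P m (F (m + k) x) = F m x" for m k x
  proof (induction k)
    case 0
    then show ?case using bdd_opsD(1)[OF F_ops] by (simp add: P_def orth_proj_id[OF L])
  next
    case (Suc k)
    have "L m \<subseteq> L (m + k)" by (rule lift_Suc_mono_le[of L, OF L_Suc]) simp
    then have "P m (F (m + Suc k) x) = P m (P (m + k) (F (Suc (m + k)) x))"
      using orth_proj_orth_proj_superset[OF L L] by (simp add: P_def)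
    then show ?case using Suc F(3)[of "m + k"] by (simp add: succ_def)
  qed
  have F_diff: "(norm (F (m + k) x - F m x))\<^sup>2 = (norm (F (m + k) x))\<^sup>2 - (norm (F m x))\<^sup>2" for m k x
    \<comment> \<open>F m x is the projection of F (m + k) x, so the increment is orthogonal to it
      and its squared norm is a difference of squared norms.\<close>
    using norm_orth_proj_Pythagoras[OF L, of "F (m + k) x" m] P_F[of m k x] by (simp add: P_def)
  have "Cauchy (\<lambda>m. F m x)" for x
  proof (rule metric_CauchyI)
    fix e :: real assume e: "0 < e"
    define a where "a m = (norm (F m x))\<^sup>2" for m
    have "incseq a"
    proof (rule incseq_SucI)
      show "a m \<le> a (Suc m)" for m
        using F_diff[of m 1 x] zero_le_power2[of "norm (F (m + 1) x - F m x)"]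
        unfolding a_def by simp
    qed
    moreover have "a m \<le> (c * norm x)\<^sup>2" for m
      unfolding a_def by (intro power_mono F_le) simp
    ultimately obtain l where "a \<longlonglongrightarrow> l" using incseq_convergent[of a] by blast
    then have "Cauchy a" using LIMSEQ_imp_Cauchy by blast
    then obtain N where N: "\<And>m k. m \<ge> N \<Longrightarrow> k \<ge> N \<Longrightarrow> dist (a m) (a k) < e\<^sup>2"
      using e by (meson metric_CauchyD zero_less_power)
    have "dist (F (m + k) x) (F m x) < e" if "m \<ge> N" for m k
    proof (rule power2_less_imp_less)
      show "(dist (F (m + k) x) (F m x))\<^sup>2 < e\<^sup>2"
        using N[of "m + k" m] that by (simp add: dist_norm F_diff a_def)
    qed (use e in simp)
    then have "dist (F j x) (F m x) < e" if "m \<ge> N" "j \<ge> m" for m j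
      using that by (metis le_add_diff_inverse)
    then have "dist (F j x) (F m x) < e" if "m \<ge> N" "j \<ge> N" for m j
      using that by (metis dist_commute nle_le)
    then show "\<exists>M. \<forall>m\<ge>M. \<forall>n\<ge>M. dist (F m x) (F n x) < e" by blast
  qed
  then have "\<exists>l. (\<lambda>m. F m x) \<longlonglongrightarrow> l" for x
    using Cauchy_convergent convergent_def by blast
  then obtain B where B: "\<And>x. (\<lambda>m. F m x) \<longlonglongrightarrow> B x" by metis
  have B_le: "norm (B x) \<le> c * norm x" for x
    using LIMSEQ_le_const2[OF tendsto_norm[OF B]] F_le by blast
  have "B \<in> bdd_ops UNIV UNIV"
  proof (rule bdd_opsI[OF _ _ _ B_le])
    show "B (x + y) = B x + B y" for x y
      using LIMSEQ_unique[OF B[of "x + y"]] tendsto_add[OF B B] by (simp add: bdd_opsD[OF F_ops])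
    show "B (a *\<^sub>C x) = a *\<^sub>C B x" for a x
      using LIMSEQ_unique[OF B[of "a *\<^sub>C x"]] tendsto_scaleC[OF B] by (simp add: bdd_opsD[OF F_ops])
  qed simp
  moreover have "orth_proj H (B x) = A x" for x
  proof -
    have "(\<lambda>m. orth_proj H (F m x)) \<longlonglongrightarrow> orth_proj H (B x)"
      using bounded_linear.tendsto[OF bdd_ops_imp_bounded_linear[OF orth_proj_in_bdd_ops[OF H]] B] .
    moreover have "orth_proj H (F m x) = A x" for m
      using P_F[of 0 m x] F(2) by (simp add: P_def L_def)
    ultimately show ?thesis by (simp add: LIMSEQ_const_iff)
  qed
  moreover have "V i (B (R i x)) = B x" if i: "i \<in> I" and x: "x \<in> X i" for i x
  proof (rule LIMSEQ_unique)
    show "(\<lambda>m. V i (F m (R i x))) \<longlonglongrightarrow> V i (B (R i x))"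
      using bounded_linear.tendsto[OF bdd_ops_imp_bounded_linear[OF V[OF i]] B] .
    \<comment> \<open>On \<open>X i\<close> this sequence is the shifted sequence F (Suc m)
      x.\<close>
    show "(\<lambda>m. V i (F m (R i x))) \<longlonglongrightarrow> B x"
      using LIMSEQ_Suc[OF B[of x]] F(3) i x by (simp add: succ_def)
  qed
  ultimately show thesis using that B_le by blast
qed

end

end

theorem theorem2p1:
  fixes n :: enat
    and H :: "'k::complex_hilbert_space set"
    and T V :: "nat \<Rightarrow> 'k \<Rightarrow> 'k"
    and X :: "nat \<Rightarrow> 'x::complex_hilbert_space set"
    and R :: "nat \<Rightarrow> 'x \<Rightarrow> 'x"
    and A :: "'x \<Rightarrow> 'k"
  assumes "n \<ge> 1"
    and "closed_csubspace H"
    and "row_contraction n H T"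
    and "isometric_lifting n H T V"
    and "\<forall>i\<in>indices n. closed_csubspace (X i)"
    and "\<forall>i\<in>indices n. \<forall>j\<in>indices n. i \<noteq> j \<longrightarrow> orthogonal_sets (X i) (X j)"
    and "\<forall>i\<in>indices n. contraction_on (X i) (R i)"
    and "A \<in> bdd_ops UNIV H"
    and "\<forall>i\<in>indices n. \<forall>x\<in>X i. T i (A (R i x)) = A x"
  shows "\<exists>B \<in> bdd_ops UNIV UNIV.
    (\<forall>x. orth_proj H (B x) = A x) \<and>
    onorm B = onorm A \<and>
    (\<forall>i\<in>indices n. \<forall>x\<in>X i. V i (B (R i x)) = B x)"
proof -
  note H = assms(2)
  have A: "bounded_linear A" using bdd_ops_imp_bounded_linear[OF assms(8)] .
  have V: "V i \<in> bdd_ops UNIV UNIV" and lift: "orth_proj H (V i x) = T i (orth_proj H x)"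
    if "i \<in> indices n" for i x
    using assms(4) that by (auto simp: isometric_lifting_def)
  \<comment> \<open>For \<open>x\<close> orthogonal to \<open>H\<close> the lifting relation gives
    P_H V_i x = T_i P_H x = T_i 0, and the same relation at 0 gives T_i 0 = 0.\<close>
  have V_orth: "cinner (V i x) h = 0"
    if i: "i \<in> indices n" and x: "\<And>h. h \<in> H \<Longrightarrow> cinner x h = 0" and h: "h \<in> H" for i x h
  proof -
    have "T i 0 = 0"
      using lift[OF i, of 0] bdd_opsD(3)[OF V[OF i], of 0 0]
      by (simp add: orth_proj_id[OF H] closed_csubspaceD(1)[OF H])
    then have "orth_proj H (V i x) = 0"
      using lift[OF i, of x] orth_proj_eq_zeroI[OF H x] by simp
    then show ?thesis using cinner_diff_orth_proj[OF H h, of "V i x"] by simp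
  qed
  \<comment> \<open>The values of \<open>A\<close> lie in \<open>H\<close>, so the lifting relation
    turns P_H V_i into T_i on them.\<close>
  have compat: "orth_proj H (V i (A (R i x))) = A x" if "i \<in> indices n" "x \<in> X i" for i x
    using that assms(9) lift bdd_opsD(1)[OF assms(8)] by (simp add: orth_proj_id[OF H])
  obtain B where B: "B \<in> bdd_ops UNIV UNIV" "\<And>x. norm (B x) \<le> onorm A * norm x"
    "\<And>x. orth_proj H (B x) = A x" "\<And>i x. i \<in> indices n \<Longrightarrow> x \<in> X i \<Longrightarrow> V i (B (R i x)) = B x"
    by (rule lifting_exists[of "indices n" V H X R A "onorm A"])
      (use V isometric_lifting_cinner[OF assms(4)] H V_orth assms(5-8) onorm_pos_le[OF A]
        onorm[OF A] compat in auto)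
  \<comment> \<open>\<open>A\<close> is the compression of \<open>B\<close> by the contraction
    P_H.\<close>
  have "onorm A \<le> onorm B"
  proof (rule onorm_bound)
    have B_lin: "bounded_linear B" using bdd_ops_imp_bounded_linear[OF B(1)] .
    show "0 \<le> onorm B" by (rule onorm_pos_le[OF B_lin])
    show "norm (A x) \<le> onorm B * norm x" for x
      using norm_orth_proj_le[OF H, of "B x"] B(3) onorm[OF B_lin, of x] by simp
  qed
  moreover have "onorm B \<le> onorm A" using B(2) by (rule onorm_bound[OF onorm_pos_le[OF A]])
  ultimately have "onorm B = onorm A" by simp
  then show ?thesis using B by (intro bexI[of _ B]) simp_all
qed

end
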